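(* Let $\mathbb K$ be a field and let $q\in\mathbb K$ be nonzero with $q^2\neq 1$. Let $z$ be the element of $U_q(\mathfrak{sl}_2)$, and $\Gamma_z$ the $U_q(\mathfrak{sl}_2)$-module with basis $v_{ij}$ ($i,j\in\mathbb Z$, $j\ge 0$), described in the context. Then: (i) $zv_{00}=0$; (ii) $z$ is not invertible on $\Gamma_z$; (iii) $z$ is not invertible in $U_q(\mathfrak{sl}_2)$.
   Context: $U_q(\mathfrak{sl}_2)$ denotes the unital associative $\mathbb K$-algebra with generators $k^{\pm1},e,f$ and relations $kk^{-1}=k^{-1}k=1$, $ke=q^2ek$, $kf=q^{-2}fk$, $ef-fe=\frac{k-k^{-1}}{q-q^{-1}}$. Its equitable generators are the elements $x^{\pm1}=k^{\pm1}$, $y=k^{-1}+f(q-q^{-1})$, $z=k^{-1}-k^{-1}e\,q(q-q^{-1})$; in terms of them $U_q(\mathfrak{sl}_2)$ is presented by the relations $xx^{-1}=x^{-1}x=1$, $\frac{qxy-q^{-1}yx}{q-q^{-1}}=\frac{qyz-q^{-1}zy}{q-q^{-1}}=\frac{qzx-q^{-1}xz}{q-q^{-1}}=1$ (the equitable presentation). $\Gamma_z$ is the $U_q(\mathfrak{sl}_2)$-module with basis $v_{ij}$ ($i,j\in\mathbb Z$, $j\geq0$) on which, with the convention $v_{r,-1}:=0$ for $r\in\mathbb Z$, $$xv_{ij}=v_{i+1,j},\qquad x^{-1}v_{ij}=v_{i-1,j},$$ $$yv_{ij}=q^{2i}v_{i,j+1}-q^i(q^i-q^{-i})v_{i-1,j},$$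 $$zv_{ij}=q^{-i}(q^i-q^{-i})v_{i-1,j}-q^{j-2i}(q^j-q^{-j})v_{i,j-1}.$$ *)

theory Defs
  imports
    "HOL-Library.Poly_Mapping"
    "HOL-Algebra.QuotRing"
    "HOL-Algebra.Algebraic_Closure_Type"
begin

section \<open>Finitely supported functions as vector spaces\<close>

definition scale :: "'k::field \<Rightarrow> ('b \<Rightarrow>\<^sub>0 'k) \<Rightarrow> ('b \<Rightarrow>\<^sub>0 'k)" where
  "scale c p = Poly_Mapping.map (\<lambda>a. c * a) p"

lemma lookup_scale [simp]:
  "Poly_Mapping.lookup (scale c p) b = c * Poly_Mapping.lookup p b"
  by (simp add: scale_def Poly_Mapping.map.rep_eq when_def)

lemma vector_space_scale: "vector_space (scale :: 'k::field \<Rightarrow> ('b \<Rightarrow>\<^sub>0 'k) \<Rightarrow> _)"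
  by unfold_locales (auto intro!: poly_mapping_eqI simp: lookup_add algebra_simps)

interpretation fsv: vector_space "scale :: 'k::field \<Rightarrow> ('b \<Rightarrow>\<^sub>0 'k) \<Rightarrow> _"
  by (rule vector_space_scale)

definition lin_ext :: "('b \<Rightarrow> ('c \<Rightarrow>\<^sub>0 'k)) \<Rightarrow> ('b \<Rightarrow>\<^sub>0 'k::field) \<Rightarrow> ('c \<Rightarrow>\<^sub>0 'k)" where
  "lin_ext T p = (\<Sum>b\<in>Poly_Mapping.keys p. scale (Poly_Mapping.lookup p b) (T b))"

lemma lin_ext_superset:
  assumes "finite B" "Poly_Mapping.keys p \<subseteq> B"
  shows "lin_ext T p = (\<Sum>b\<in>B. scale (Poly_Mapping.lookup p b) (T b))"
  unfolding lin_ext_def using assms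
  by (intro sum.mono_neutral_left) (auto simp: in_keys_iff)

lemma lin_ext_add: "lin_ext T (p + r) = lin_ext T p + lin_ext T r"
proof -
  let ?B = "Poly_Mapping.keys p \<union> Poly_Mapping.keys r"
  have "lin_ext T (p + r) = (\<Sum>b\<in>?B. scale (Poly_Mapping.lookup (p + r) b) (T b))"
    by (rule lin_ext_superset) (auto simp: Poly_Mapping.keys_add)
  also have "\<dots> = (\<Sum>b\<in>?B. scale (Poly_Mapping.lookup p b) (T b))
      + (\<Sum>b\<in>?B. scale (Poly_Mapping.lookup r b) (T b))"
    by (simp add: lookup_add fsv.scale_left_distrib sum.distrib)
  also have "\<dots> = lin_ext T p + lin_ext T r"
    by (simp add: lin_ext_superset[of ?B])
  finally show ?thesis .
qed

lemma keys_scale: "Poly_Mapping.keys (scale c p) \<subseteq> Poly_Mapping.keys p"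
  by (auto simp: in_keys_iff)

lemma lin_ext_scale: "lin_ext T (scale c p) = scale c (lin_ext T p)"
  by (subst lin_ext_superset[OF finite_keys keys_scale])
    (simp add: lin_ext_def fsv.scale_sum_right)

lemma lin_ext_single [simp]: "lin_ext T (Poly_Mapping.single b c) = scale c (T b)"
  by (cases "c = 0") (simp_all add: lin_ext_def)

lemma linear_lin_ext: "Vector_Spaces.linear scale scale (lin_ext T)"
  by unfold_locales (simp_all add: lin_ext_add lin_ext_scale)

lemma scale_single [simp]:
  "scale c (Poly_Mapping.single b a) = Poly_Mapping.single b (c * a)"
  by (rule poly_mapping_eqI) (simp add: lookup_single when_def)

lemma poly_mapping_single_induct [case_names single sum]:
  fixes p :: "'b \<Rightarrow>\<^sub>0 'k::ab_group_add"
  assumes single: "\<And>b c. P (Poly_Mapping.single b c)"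
    and sum: "\<And>p r. P p \<Longrightarrow> P r \<Longrightarrow> P (p + r)"
  shows "P p"
proof (induction p rule: update_induct)
  case const
  show ?case using single[of undefined 0] by simp
next
  case (update p b c)
  have "Poly_Mapping.update b c p = p + Poly_Mapping.single b c"
    using update(1)
    by (intro poly_mapping_eqI)
      (auto simp: lookup_update lookup_add lookup_single when_def in_keys_iff)
  then show ?case using sum[OF update(3) single] by simp
qed

lemma linear_eq_on_singles:
  fixes S T :: "('b \<Rightarrow>\<^sub>0 'k::field) \<Rightarrow> ('c \<Rightarrow>\<^sub>0 'k)"
  assumes S: "Vector_Spaces.linear scale scale S" and T: "Vector_Spaces.linear scale scale T"
    and eq: "\<And>b. S (Poly_Mapping.single b 1) = T (Poly_Mapping.single b 1)"
  shows "S p = T p"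
proof -
  interpret S: Vector_Spaces.linear scale scale S by (rule S)
  interpret T: Vector_Spaces.linear scale scale T by (rule T)
  show ?thesis
  proof (induction p rule: poly_mapping_single_induct)
    case (single b c)
    have "Poly_Mapping.single b c = scale c (Poly_Mapping.single b (1::'k))" by simp
    then show ?case
      by (metis S.scale T.scale eq)
  next
    case (sum p r)
    then show ?case
      by (simp add: S.add T.add)
  qed
qed


section \<open>The algebra \<open>U\<^sub>q(sl\<^sub>2)\<close>\<close>

datatype uq_gen = Gen_k | Gen_kinv | Gen_e | Gen_f

text \<open>
  Words in the generators, as a monoid written additively (so that the convolution product of
  \<^typ>\<open>'a \<Rightarrow>\<^sub>0 'b\<close> makes the finitely supported functions on words the free associative algebra).
\<close>

datatype uq_word = Word (letters: "uq_gen list")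

instantiation uq_word :: monoid_add
begin
definition zero_uq_word :: uq_word where "0 = Word []"
definition plus_uq_word :: "uq_word \<Rightarrow> uq_word \<Rightarrow> uq_word"
  where "u + v = Word (letters u @ letters v)"
instance
  by standard (simp_all add: zero_uq_word_def plus_uq_word_def)
end

type_synonym 'k uq_free = "uq_word \<Rightarrow>\<^sub>0 'k"

definition cst :: "'k \<Rightarrow> 'k::field uq_free" where
  "cst c = Poly_Mapping.single 0 c"

definition gen :: "uq_gen \<Rightarrow> 'k::field uq_free" where
  "gen g = Poly_Mapping.single (Word [g]) 1"

definition uq_relators :: "'k::field \<Rightarrow> 'k uq_free set" where
  "uq_relators q =
    {gen Gen_k * gen Gen_kinv - 1,
     gen Gen_kinv * gen Gen_k - 1,
     gen Gen_k * gen Gen_e - cst (q ^ 2) * gen Gen_e * gen Gen_k,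
     gen Gen_k * gen Gen_f - cst (inverse (q ^ 2)) * gen Gen_f * gen Gen_k,
     gen Gen_e * gen Gen_f - gen Gen_f * gen Gen_e
       - cst (inverse (q - inverse q)) * (gen Gen_k - gen Gen_kinv)}"

text \<open>
  Ideals of HOL-Algebra are two-sided. The quotient is recorded as a ring only; its
  algebra structure over the ground field is given by the central elements
  \<open>uq_class q (cst c)\<close>.
\<close>

definition uq_ideal :: "'k::field \<Rightarrow> 'k uq_free set" where
  "uq_ideal q = genideal ring_of_type_algebra (uq_relators q)"

definition Uq :: "'k::field \<Rightarrow> 'k uq_free set ring" where
  "Uq q = ring_of_type_algebra Quot uq_ideal q"

definition uq_class :: "'k::field \<Rightarrow> 'k uq_free \<Rightarrow> 'k uq_free set" where
  "uq_class q p = uq_ideal q +>\<^bsub>ring_of_type_algebra\<^esub> p"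

definition uq_x :: "'k::field \<Rightarrow> 'k uq_free set" where
  "uq_x q = uq_class q (gen Gen_k)"

definition uq_xinv :: "'k::field \<Rightarrow> 'k uq_free set" where
  "uq_xinv q = uq_class q (gen Gen_kinv)"

definition uq_y :: "'k::field \<Rightarrow> 'k uq_free set" where
  "uq_y q = uq_class q (gen Gen_kinv + gen Gen_f * cst (q - inverse q))"

definition uq_z :: "'k::field \<Rightarrow> 'k uq_free set" where
  "uq_z q = uq_class q (gen Gen_kinv - gen Gen_kinv * gen Gen_e * cst (q * (q - inverse q)))"

lemma ring_free: "ring (ring_of_type_algebra :: 'a::ring_1 ring)"
proof -
  have "\<exists>y. x + y = 0" for x :: 'a
    using add.right_inverse by blast
  then show ?thesis
    unfolding ring_of_type_algebra_def using add.right_inverse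
    by unfold_locales (auto simp: algebra_simps Units_def)
qed

lemma ideal_uq_ideal: "ideal (uq_ideal q) ring_of_type_algebra"
  unfolding uq_ideal_def
  by (rule ring.genideal_ideal[OF ring_free]) (simp add: ring_of_type_algebra_def)

lemma ring_Uq: "ring (Uq q)"
  unfolding Uq_def by (rule ideal.quotient_is_ring[OF ideal_uq_ideal])


section \<open>The module \<open>\<Gamma>\<^sub>z\<close>\<close>

type_synonym 'k Gamma = "(int \<times> nat) \<Rightarrow>\<^sub>0 'k"

text \<open>The second index ranges over \<^typ>\<open>int\<close> so that \<open>v\<^sub>r\<^sub>,\<^sub>-\<^sub>1 = 0\<close> can be said.\<close>

definition vv :: "int \<Rightarrow> int \<Rightarrow> 'k::field Gamma" where
  "vv i j = (if j < 0 then 0 else Poly_Mapping.single (i, nat j) 1)"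

definition Gamma_X :: "'k::field Gamma \<Rightarrow> 'k Gamma" where
  "Gamma_X = lin_ext (\<lambda>(i, n). vv (i + 1) (int n))"

definition Gamma_Xinv :: "'k::field Gamma \<Rightarrow> 'k Gamma" where
  "Gamma_Xinv = lin_ext (\<lambda>(i, n). vv (i - 1) (int n))"

definition Gamma_Y :: "'k::field \<Rightarrow> 'k Gamma \<Rightarrow> 'k Gamma" where
  "Gamma_Y q = lin_ext (\<lambda>(i, n). let j = int n in
     scale (q powi (2 * i)) (vv i (j + 1))
     - scale (q powi i * (q powi i - q powi (- i))) (vv (i - 1) j))"

definition Gamma_Z :: "'k::field \<Rightarrow> 'k Gamma \<Rightarrow> 'k Gamma" where
  "Gamma_Z q = lin_ext (\<lambda>(i, n). let j = int n in
     scale (q powi (- i) * (q powi i - q powi (- i))) (vv (i - 1) j)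
     - scale (q powi (j - 2 * i) * (q powi j - q powi (- j))) (vv i (j - 1)))"

text \<open>
  The action of the generators \<open>k\<^sup>\<plusminus>\<^sup>1, e, f\<close>, obtained by solving
  \<open>y = k\<^sup>-\<^sup>1 + f(q - q\<^sup>-\<^sup>1)\<close> and \<open>z = k\<^sup>-\<^sup>1 - k\<^sup>-\<^sup>1 e q(q - q\<^sup>-\<^sup>1)\<close> for \<open>f\<close> and \<open>e\<close>.
\<close>

fun gen_op :: "'k::field \<Rightarrow> uq_gen \<Rightarrow> 'k Gamma \<Rightarrow> 'k Gamma" where
  "gen_op q Gen_k w = Gamma_X w"
| "gen_op q Gen_kinv w = Gamma_Xinv w"
| "gen_op q Gen_e w = scale (inverse (q * (q - inverse q))) (w - Gamma_X (Gamma_Z q w))"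
| "gen_op q Gen_f w = scale (inverse (q - inverse q)) (Gamma_Y q w - Gamma_Xinv w)"

definition free_act :: "'k::field \<Rightarrow> 'k uq_free \<Rightarrow> 'k Gamma \<Rightarrow> 'k Gamma" where
  "free_act q p w = lin_ext (\<lambda>u. foldr (gen_op q) (letters u) w) p"

text \<open>
  All representatives of an element of \<open>U\<^sub>q(sl\<^sub>2)\<close> act by the same operator, see
  \<open>uq_act_class\<close> below.
\<close>

definition uq_act :: "'k::field \<Rightarrow> 'k uq_free set \<Rightarrow> 'k Gamma \<Rightarrow> 'k Gamma" where
  "uq_act q a = the_elem (free_act q ` a)"

definition Gamma_End :: "('k::field Gamma \<Rightarrow> 'k Gamma) ring" where
  "Gamma_End = \<lparr>carrier = {T. Vector_Spaces.linear scale scale T},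
     monoid.mult = (\<circ>), one = id, ring.zero = (\<lambda>_. 0), add = (\<lambda>S T w. S w + T w)\<rparr>"

lemma linear_Gamma_X: "Vector_Spaces.linear scale scale Gamma_X"
  and linear_Gamma_Xinv: "Vector_Spaces.linear scale scale Gamma_Xinv"
  and linear_Gamma_Y: "Vector_Spaces.linear scale scale (Gamma_Y q)"
  and linear_Gamma_Z: "Vector_Spaces.linear scale scale (Gamma_Z q)"
  by (simp_all add: Gamma_X_def Gamma_Xinv_def Gamma_Y_def Gamma_Z_def linear_lin_ext)

interpretation GX: Vector_Spaces.linear scale scale "Gamma_X :: 'k::field Gamma \<Rightarrow> _"
  by (rule linear_Gamma_X)
interpretation GXi: Vector_Spaces.linear scale scale "Gamma_Xinv :: 'k::field Gamma \<Rightarrow> _"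
  by (rule linear_Gamma_Xinv)
interpretation GY: Vector_Spaces.linear scale scale "Gamma_Y q :: 'k::field Gamma \<Rightarrow> _" for q
  by (rule linear_Gamma_Y)
interpretation GZ: Vector_Spaces.linear scale scale "Gamma_Z q :: 'k::field Gamma \<Rightarrow> _" for q
  by (rule linear_Gamma_Z)

lemma single_eq_vv: "Poly_Mapping.single (i, n) 1 = vv i (int n)"
  by (simp add: vv_def)

lemma vv_neg [simp]: "j < 0 \<Longrightarrow> vv i j = 0"
  by (simp add: vv_def)

lemma Gamma_X_vv: "Gamma_X (vv i j) = vv (i + 1) j"
  by (simp add: vv_def Gamma_X_def lin_ext_def)

lemma Gamma_Xinv_vv: "Gamma_Xinv (vv i j) = vv (i - 1) j"
  by (simp add: vv_def Gamma_Xinv_def lin_ext_def)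

lemma Gamma_Y_vv:
  assumes "j \<ge> 0"
  shows "Gamma_Y q (vv i j) = scale (q powi (2 * i)) (vv i (j + 1))
     - scale (q powi i * (q powi i - q powi (- i))) (vv (i - 1) j)"
  using assms by (simp add: vv_def[of i j] Gamma_Y_def Let_def)

lemma Gamma_Z_vv:
  assumes "j \<ge> 0"
  shows "Gamma_Z q (vv i j) = scale (q powi (- i) * (q powi i - q powi (- i))) (vv (i - 1) j)
     - scale (q powi (j - 2 * i) * (q powi j - q powi (- j))) (vv i (j - 1))"
  proof -
  have v: "vv i j = Poly_Mapping.single (i, nat j) 1" and j: "int (nat j) = j"
    using assms by (simp_all add: vv_def)
  show ?thesis
    by (subst v) (simp only: Gamma_Z_def lin_ext_single Let_def prod.case j fsv.scale_one)
qed

lemma Gamma_X_Xinv: "Gamma_X (Gamma_Xinv w) = w"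
  and Gamma_Xinv_X: "Gamma_Xinv (Gamma_X w) = w"
proof -
  show "Gamma_X (Gamma_Xinv w) = w"
    by (rule linear_eq_on_singles[where S = "\<lambda>w. Gamma_X (Gamma_Xinv w)" and T = "\<lambda>w. w"])
      (auto simp: single_eq_vv Gamma_X_vv Gamma_Xinv_vv Vector_Spaces.linear_iff fsv.vector_space_axioms
        GX.add GXi.add GX.scale GXi.scale)
  show "Gamma_Xinv (Gamma_X w) = w"
    by (rule linear_eq_on_singles[where S = "\<lambda>w. Gamma_Xinv (Gamma_X w)" and T = "\<lambda>w. w"])
      (auto simp: single_eq_vv Gamma_X_vv Gamma_Xinv_vv Vector_Spaces.linear_iff fsv.vector_space_axioms
        GX.add GXi.add GX.scale GXi.scale)
qed

lemma linear_q_comm: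
  assumes S: "Vector_Spaces.linear scale scale S" and T: "Vector_Spaces.linear scale scale T"
  shows "Vector_Spaces.linear scale scale (\<lambda>w. scale a (S (T w)) - scale b (T (S w)))"
proof -
  interpret S: Vector_Spaces.linear scale scale S by (rule S)
  interpret T: Vector_Spaces.linear scale scale T by (rule T)
  show ?thesis
    by unfold_locales (simp_all add: S.add T.add S.scale T.scale algebra_simps
      fsv.scale_right_distrib fsv.scale_right_diff_distrib)
qed

lemma linear_scale: "Vector_Spaces.linear scale scale (scale c)"
  by (rule fsv.linear_scale_self)

lemma powi_double: "q \<noteq> 0 \<Longrightarrow> (q::'k::field) powi (2 * i) = q powi i * q powi i"
  by (metis mult_2 power_int_add)

lemma Gamma_Y_vv':
  assumes "q \<noteq> 0" "j \<ge> 0"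
  shows "Gamma_Y q (vv i j) = scale (q powi i * q powi i) (vv i (j + 1))
     - scale (q powi i * q powi i - 1) (vv (i - 1) j)"
  using assms by (simp add: Gamma_Y_vv powi_double power_int_minus right_diff_distrib)

lemma Gamma_Z_vv':
  assumes "q \<noteq> 0" "j \<ge> 0"
  shows "Gamma_Z q (vv i j) = scale (1 - inverse (q powi i * q powi i)) (vv (i - 1) j)
     - scale (inverse (q powi i * q powi i) * (q powi j * q powi j - 1)) (vv i (j - 1))"
proof -
  have "q powi (j - 2 * i) * (q powi j - q powi (- j))
      = inverse (q powi i * q powi i) * (q powi j * q powi j - 1)"
    using assms(1) by (simp only: power_int_diff[OF disjI1[OF assms(1)]] powi_double[OF assms(1)] power_int_minus)
      (simp add: field_simps)
  then show ?thesis
    using assms by (simp add: Gamma_Z_vv power_int_minus right_diff_distrib)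
qed

lemma Gamma_XY:
  assumes q: "q \<noteq> 0"
  shows "scale q (Gamma_X (Gamma_Y q w)) - scale (inverse q) (Gamma_Y q (Gamma_X w))
    = scale (q - inverse q) w"
proof (rule linear_eq_on_singles[OF linear_q_comm[OF linear_Gamma_X linear_Gamma_Y] linear_scale],
    clarsimp simp only: split_paired_all)
  fix i n
  show "scale q (Gamma_X (Gamma_Y q (Poly_Mapping.single (i, n) 1)))
      - scale (inverse q) (Gamma_Y q (Gamma_X (Poly_Mapping.single (i, n) 1)))
    = scale (q - inverse q) (Poly_Mapping.single (i, n) 1)"
    using q unfolding single_eq_vv
    by (simp add: Gamma_X_vv Gamma_Y_vv' Gamma_Z_vv' power_int_add power_int_diff
        GX.diff GX.scale GY.diff GY.scale GZ.diff GZ.scale)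
      (rule poly_mapping_eqI, simp add: lookup_minus lookup_add field_simps)
qed

lemma Gamma_ZX:
  assumes q: "q \<noteq> 0"
  shows "scale q (Gamma_Z q (Gamma_X w)) - scale (inverse q) (Gamma_X (Gamma_Z q w))
    = scale (q - inverse q) w"
proof (rule linear_eq_on_singles[OF linear_q_comm[OF linear_Gamma_Z linear_Gamma_X] linear_scale],
    clarsimp simp only: split_paired_all)
  fix i n
  show "scale q (Gamma_Z q (Gamma_X (Poly_Mapping.single (i, n) 1)))
      - scale (inverse q) (Gamma_X (Gamma_Z q (Poly_Mapping.single (i, n) 1)))
    = scale (q - inverse q) (Poly_Mapping.single (i, n) 1)"
    using q unfolding single_eq_vv
    by (simp add: Gamma_X_vv Gamma_Y_vv' Gamma_Z_vv' power_int_add power_int_diff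
        GX.diff GX.scale GY.diff GY.scale GZ.diff GZ.scale)
      (rule poly_mapping_eqI, simp add: lookup_minus lookup_add field_simps)
qed

lemma Gamma_YZ:
  assumes q: "q \<noteq> 0"
  shows "scale q (Gamma_Y q (Gamma_Z q w)) - scale (inverse q) (Gamma_Z q (Gamma_Y q w))
    = scale (q - inverse q) w"
proof (rule linear_eq_on_singles[OF linear_q_comm[OF linear_Gamma_Y linear_Gamma_Z] linear_scale],
    clarsimp simp only: split_paired_all)
  fix i n
  show "scale q (Gamma_Y q (Gamma_Z q (Poly_Mapping.single (i, n) 1)))
      - scale (inverse q) (Gamma_Z q (Gamma_Y q (Poly_Mapping.single (i, n) 1)))
    = scale (q - inverse q) (Poly_Mapping.single (i, n) 1)"
    using q unfolding single_eq_vv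
    by (cases n)
      (simp_all add: Gamma_Y_vv' Gamma_Z_vv' power_int_add power_int_diff
        GY.diff GY.scale GZ.diff GZ.scale,
       (rule poly_mapping_eqI, simp add: lookup_minus lookup_add field_simps eval_nat_numeral)+)
qed

lemma linear_gen_op: "Vector_Spaces.linear scale scale (gen_op q g)"
  by (cases g; unfold_locales)
    (simp_all add: GX.add GXi.add GY.add GZ.add GX.scale GXi.scale GY.scale GZ.scale
      fsv.scale_right_distrib fsv.scale_right_diff_distrib algebra_simps)

interpretation gop: Vector_Spaces.linear scale scale "gen_op q g" for q g
  by (rule linear_gen_op)

lemma linear_word: "Vector_Spaces.linear scale scale (foldr (gen_op q) us)"
  by (induction us) (auto simp: Vector_Spaces.linear_iff fsv.vector_space_axioms gop.add gop.scale)

lemma linear_free_act: "Vector_Spaces.linear scale scale (free_act q p)"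
proof -
  interpret w: Vector_Spaces.linear scale scale "foldr (gen_op q) us" for us
    by (rule linear_word)
  show ?thesis
    by unfold_locales (simp_all add: free_act_def lin_ext_def w.add w.scale fsv.scale_right_distrib
        sum.distrib fsv.scale_sum_right fsv.scale_left_commute mult.commute)
qed

interpretation fa: Vector_Spaces.linear scale scale "free_act q p" for q p
  by (rule linear_free_act)

lemma free_act_single:
  "free_act q (Poly_Mapping.single u c) w = scale c (foldr (gen_op q) (letters u) w)"
  by (simp add: free_act_def)

lemma free_act_add: "free_act q (p + r) w = free_act q p w + free_act q r w"
  by (simp add: free_act_def lin_ext_add)

lemma free_act_zero [simp]: "free_act q 0 w = 0"
  by (simp add: free_act_def lin_ext_def)

lemma free_act_diff: "free_act q (p - r) w = free_act q p w - free_act q r w"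
  using free_act_add[of q "p - r" r w] by simp

lemma free_act_one [simp]: "free_act q 1 w = w"
  unfolding single_one[symmetric] free_act_single by (simp add: zero_uq_word_def)

lemma free_act_cst [simp]: "free_act q (cst c) w = scale c w"
  by (simp add: cst_def free_act_single zero_uq_word_def)

lemma free_act_gen [simp]: "free_act q (gen g) w = gen_op q g w"
  by (simp add: gen_def free_act_single)

lemma free_act_mult: "free_act q (p * r) w = free_act q p (free_act q r w)"
proof (induction p rule: poly_mapping_single_induct)
  case (sum p1 p2)
  then show ?case by (simp add: distrib_right free_act_add)
next
  case (single u c)
  interpret w: Vector_Spaces.linear scale scale "foldr (gen_op q) us" for us
    by (rule linear_word)
  show ?case
  proof (induction r rule: poly_mapping_single_induct)
    case (sum r1 r2)
    then show ?case by (simp add: distrib_left free_act_add fa.add)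
  next
    case (single v d)
    show ?case
      by (simp add: mult_single free_act_single plus_uq_word_def w.scale)
  qed
qed

lemma Gamma_YX:
  assumes "q \<noteq> 0"
  shows "Gamma_Y q (Gamma_X w) = scale (q ^ 2) (Gamma_X (Gamma_Y q w)) - scale (q ^ 2 - 1) w"
proof -
  have "scale (inverse q) (Gamma_Y q (Gamma_X w))
    = scale q (Gamma_X (Gamma_Y q w)) - scale (q - inverse q) w"
    using Gamma_XY[OF assms, of w] by (simp add: algebra_simps)
  then have "scale q (scale (inverse q) (Gamma_Y q (Gamma_X w)))
    = scale q (scale q (Gamma_X (Gamma_Y q w)) - scale (q - inverse q) w)"
    by simp
  then show ?thesis
    using assms by (simp add: fsv.scale_right_diff_distrib power2_eq_square right_diff_distrib)
qed

lemma Gamma_XZ: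
  assumes "q \<noteq> 0"
  shows "Gamma_X (Gamma_Z q w) = scale (q ^ 2) (Gamma_Z q (Gamma_X w)) - scale (q ^ 2 - 1) w"
proof -
  have "scale (inverse q) (Gamma_X (Gamma_Z q w))
    = scale q (Gamma_Z q (Gamma_X w)) - scale (q - inverse q) w"
    using Gamma_ZX[OF assms, of w] by (simp add: algebra_simps)
  then have "scale q (scale (inverse q) (Gamma_X (Gamma_Z q w)))
    = scale q (scale q (Gamma_Z q (Gamma_X w)) - scale (q - inverse q) w)"
    by simp
  then show ?thesis
    using assms by (simp add: fsv.scale_right_diff_distrib power2_eq_square right_diff_distrib)
qed

lemma Gamma_ZY:
  assumes "q \<noteq> 0"
  shows "Gamma_Z q (Gamma_Y q w) = scale (q ^ 2) (Gamma_Y q (Gamma_Z q w)) - scale (q ^ 2 - 1) w"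
proof -
  have "scale (inverse q) (Gamma_Z q (Gamma_Y q w))
    = scale q (Gamma_Y q (Gamma_Z q w)) - scale (q - inverse q) w"
    using Gamma_YZ[OF assms, of w] by (simp add: algebra_simps)
  then have "scale q (scale (inverse q) (Gamma_Z q (Gamma_Y q w)))
    = scale q (scale q (Gamma_Y q (Gamma_Z q w)) - scale (q - inverse q) w)"
    by simp
  then show ?thesis
    using assms by (simp add: fsv.scale_right_diff_distrib power2_eq_square right_diff_distrib)
qed

lemma free_act_relator:
  assumes q: "q \<noteq> 0" "q ^ 2 \<noteq> 1" and p: "p \<in> uq_relators q"
  shows "free_act q p w = 0"
proof -
  have nz: "q - inverse q \<noteq> 0"
    using q by (auto simp: power2_eq_square field_simps)
  define s where "s = inverse (q - inverse q)"
  define t where "t = inverse (q * (q - inverse q))"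
  have ke: "gen_op q Gen_k (gen_op q Gen_e w) = scale (q ^ 2) (gen_op q Gen_e (gen_op q Gen_k w))"
  proof -
    have "Gamma_X (w - Gamma_X (Gamma_Z q w)) = scale (q ^ 2) (Gamma_X w - Gamma_X (Gamma_Z q (Gamma_X w)))"
      by (subst Gamma_XZ[OF q(1)])
        (simp add: GX.diff GX.scale fsv.scale_right_diff_distrib fsv.scale_left_diff_distrib)
    then show ?thesis
      by (simp add: GX.scale mult.commute)
  qed
  have kf: "gen_op q Gen_k (gen_op q Gen_f w)
    = scale (inverse (q ^ 2)) (gen_op q Gen_f (gen_op q Gen_k w))"
  proof -
    have "Gamma_X (Gamma_Y q w - Gamma_Xinv w)
      = scale (inverse (q ^ 2)) (Gamma_Y q (Gamma_X w) - Gamma_Xinv (Gamma_X w))"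
      using q(1) by (simp add: Gamma_YX[OF q(1)] GX.diff Gamma_X_Xinv Gamma_Xinv_X
        fsv.scale_right_diff_distrib fsv.scale_left_diff_distrib right_diff_distrib)
    then show ?thesis
      by (simp add: GX.scale mult.commute)
  qed
  have ef: "gen_op q Gen_e (gen_op q Gen_f w) - gen_op q Gen_f (gen_op q Gen_e w)
    = scale s (Gamma_X w - Gamma_Xinv w)"
  proof -
    let ?X = Gamma_X and ?Xi = Gamma_Xinv and ?Y = "Gamma_Y q" and ?Z = "Gamma_Z q"
    have a: "?X (?Z (?Xi w)) = scale (q ^ 2) (?Z w) - scale (q ^ 2 - 1) (?Xi w)"
      by (simp add: Gamma_XZ[OF q(1)] Gamma_X_Xinv)
    have b: "?Y (?X (?Z w)) = ?X (?Z (?Y w)) + scale (q ^ 2 - 1) (?X w) - scale (q ^ 2 - 1) (?Z w)"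
      by (simp add: Gamma_YX[OF q(1)] Gamma_ZY[OF q(1)] GX.diff GX.scale)
    have c: "(?Y w - ?Xi w) - ?X (?Z (?Y w - ?Xi w)) - (?Y (w - ?X (?Z w)) - ?Xi (w - ?X (?Z w)))
      = scale (q ^ 2 - 1) (?X w - ?Xi w)"
      by (simp add: GX.diff GY.diff GZ.diff GXi.diff Gamma_Xinv_X a b
        fsv.scale_right_diff_distrib fsv.scale_left_diff_distrib)
    have "gen_op q Gen_e (gen_op q Gen_f w) - gen_op q Gen_f (gen_op q Gen_e w)
      = scale (t * s) ((?Y w - ?Xi w) - ?X (?Z (?Y w - ?Xi w))
          - (?Y (w - ?X (?Z w)) - ?Xi (w - ?X (?Z w))))"
      by (simp only: gen_op.simps s_def[symmetric] t_def[symmetric] GX.scale GZ.scale GY.scale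
        GXi.scale GX.diff GZ.diff GY.diff GXi.diff fsv.scale_right_diff_distrib fsv.scale_scale
        mult.commute[of s t])
    also have "\<dots> = scale (t * s * (q ^ 2 - 1)) (?X w - ?Xi w)"
      by (simp only: c fsv.scale_scale)
    also have "t * s * (q ^ 2 - 1) = s"
    proof -
      have "q ^ 2 - 1 = q * (q - inverse q)"
        using q(1) by (simp add: right_diff_distrib power2_eq_square)
      moreover have "t * (q * (q - inverse q)) = 1"
        unfolding t_def by (rule left_inverse) (use q(1) nz in simp)
      ultimately have "t * (q ^ 2 - 1) = 1"
        by simp
      then show ?thesis by (metis mult.commute mult.left_commute mult_1_right)
    qed
    finally show ?thesis .
  qed
  from p consider "p = gen Gen_k * gen Gen_kinv - 1" | "p = gen Gen_kinv * gen Gen_k - 1"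
    | "p = gen Gen_k * gen Gen_e - cst (q ^ 2) * gen Gen_e * gen Gen_k"
    | "p = gen Gen_k * gen Gen_f - cst (inverse (q ^ 2)) * gen Gen_f * gen Gen_k"
    | "p = gen Gen_e * gen Gen_f - gen Gen_f * gen Gen_e
       - cst (inverse (q - inverse q)) * (gen Gen_k - gen Gen_kinv)"
    unfolding uq_relators_def by blast
  then show ?thesis
  proof cases
    case 1
    then show ?thesis by (simp add: free_act_diff free_act_mult Gamma_X_Xinv)
  next
    case 2
    then show ?thesis by (simp add: free_act_diff free_act_mult Gamma_Xinv_X)
  next
    case 3
    then show ?thesis
      by (simp only: free_act_diff free_act_mult free_act_gen free_act_cst ke diff_self)
  next
    case 4
    then show ?thesis
      by (simp only: free_act_diff free_act_mult free_act_gen free_act_cst kf diff_self)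
  next
    case 5
    then show ?thesis
      by (simp only: free_act_diff free_act_mult free_act_gen free_act_cst ef s_def
        gen_op.simps(1,2) diff_self)
  qed
qed

lemma ring_Gamma_End: "ring (Gamma_End :: ('k::field Gamma \<Rightarrow> 'k Gamma) ring)"
proof (rule ringI)
  show "abelian_group (Gamma_End :: ('k Gamma \<Rightarrow> 'k Gamma) ring)"
  proof (rule abelian_groupI)
    fix T :: "'k Gamma \<Rightarrow> 'k Gamma"
    assume T: "T \<in> carrier Gamma_End"
    show "\<exists>S\<in>carrier Gamma_End. S \<oplus>\<^bsub>Gamma_End\<^esub> T = \<zero>\<^bsub>Gamma_End\<^esub>"
      by (rule bexI[of _ "\<lambda>w. - T w"])
        (use T in \<open>auto simp: Gamma_End_def Vector_Spaces.linear_iff\<close>)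
  qed (auto simp: Gamma_End_def Vector_Spaces.linear_iff fsv.vector_space_axioms
      fsv.scale_right_distrib fun_eq_iff add_ac)
  show "Group.monoid (Gamma_End :: ('k Gamma \<Rightarrow> 'k Gamma) ring)"
    by (rule monoidI) (auto simp: Gamma_End_def Vector_Spaces.linear_iff fsv.vector_space_axioms
        fun_eq_iff)
qed (auto simp: Gamma_End_def Vector_Spaces.linear_iff fun_eq_iff)

lemma free_act_ring_hom: "ring_hom_ring ring_of_type_algebra Gamma_End (free_act q)"
  by (rule ring_hom_ringI[OF ring_free ring_Gamma_End])
    (auto simp: ring_of_type_algebra_def Gamma_End_def linear_free_act free_act_mult free_act_add
      fun_eq_iff)

lemma free_act_ideal:
  assumes q: "q \<noteq> 0" "q ^ 2 \<noteq> 1" and p: "p \<in> uq_ideal q"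
  shows "free_act q p w = 0"
proof -
  have "uq_ideal q \<subseteq> a_kernel ring_of_type_algebra Gamma_End (free_act q)"
    unfolding uq_ideal_def
  proof (rule ring.genideal_minimal[OF ring_free ring_hom_ring.kernel_is_ideal[OF free_act_ring_hom]])
    show "uq_relators q \<subseteq> a_kernel ring_of_type_algebra Gamma_End (free_act q)"
    proof
      fix r assume "r \<in> uq_relators q"
      then have "free_act q r = (\<lambda>_. 0)"
        by (intro ext) (rule free_act_relator[OF q])
      then show "r \<in> a_kernel ring_of_type_algebra Gamma_End (free_act q)"
        by (simp add: a_kernel_def' ring_of_type_algebra_def Gamma_End_def)
    qed
  qed
  with p have "free_act q p = \<zero>\<^bsub>Gamma_End\<^esub>"
    unfolding a_kernel_def' by blast
  then show ?thesis
    by (simp add: Gamma_End_def)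
qed

theorem uq_act_class:
  assumes "q \<noteq> 0" "q ^ 2 \<noteq> 1"
  shows "uq_act q (uq_class q p) = free_act q p"
proof -
  have "0 \<in> uq_ideal q"
    using additive_subgroup.zero_closed[OF ideal.axioms(1)[OF ideal_uq_ideal[of q]]]
    by (simp add: ring_of_type_algebra_def)
  then have ne: "p \<in> uq_class q p"
    unfolding uq_class_def a_r_coset_def' ring_of_type_algebra_def
    by (auto intro!: bexI[of _ 0])
  have "free_act q r = free_act q p" if r: "r \<in> uq_class q p" for r
  proof -
    obtain h where h: "h \<in> uq_ideal q" "r = h + p"
      using r by (auto simp: uq_class_def a_r_coset_def' ring_of_type_algebra_def)
    show ?thesis
      by (rule ext) (simp add: h free_act_add free_act_ideal[OF assms h(1)])
  qed
  then show ?thesis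
    unfolding uq_act_def using ne by (intro the_elem_image_unique) blast+
qed

text \<open>So \<^const>\<open>uq_act\<close> makes \<open>\<Gamma>\<^sub>z\<close> a \<open>U\<^sub>q(sl\<^sub>2)\<close>-module, with \<open>x\<^sup>\<plusminus>\<^sup>1, y, z\<close> acting as required.\<close>

theorem uq_act_ring_hom:
  assumes "q \<noteq> 0" "q ^ 2 \<noteq> 1"
  shows "uq_act q \<in> ring_hom (Uq q) Gamma_End"
proof -
  let ?F = "ring_of_type_algebra :: 'a uq_free ring"
  note cls = uq_act_class[OF assms]
  have carr: "carrier (Uq q) = range (uq_class q)"
    by (auto simp: Uq_def FactRing_def A_RCOSETS_def' uq_class_def ring_of_type_algebra_def)
  have rh: "uq_class q \<in> ring_hom ?F (Uq q)"
    unfolding uq_class_def[abs_def] Uq_def by (rule ideal.rcos_ring_hom[OF ideal_uq_ideal])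
  have mult: "uq_class q p \<otimes>\<^bsub>Uq q\<^esub> uq_class q r = uq_class q (p * r)" for p r
    using ring_hom_mult[OF rh, of p r] by (simp add: ring_of_type_algebra_def)
  have add: "uq_class q p \<oplus>\<^bsub>Uq q\<^esub> uq_class q r = uq_class q (p + r)" for p r
    using ring_hom_add[OF rh, of p r] by (simp add: ring_of_type_algebra_def)
  have one: "\<one>\<^bsub>Uq q\<^esub> = uq_class q 1"
    using ring_hom_one[OF rh] by (simp add: ring_of_type_algebra_def)
  show ?thesis
    by (rule ring_hom_memI)
      (auto simp: carr mult add one cls Gamma_End_def linear_free_act free_act_mult free_act_add
        fun_eq_iff)
qed

theorem uq_act_generators:
  assumes "q \<noteq> 0" "q ^ 2 \<noteq> 1"
  shows "uq_act q (uq_class q (cst c)) = scale c"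
    and "uq_act q (uq_x q) = Gamma_X"
    and "uq_act q (uq_xinv q) = Gamma_Xinv"
    and "uq_act q (uq_y q) = Gamma_Y q"
    and "uq_act q (uq_z q) = Gamma_Z q"
proof -
  have nz: "q - inverse q \<noteq> 0"
    using assms by (auto simp: power2_eq_square field_simps)
  show "uq_act q (uq_class q (cst c)) = scale c"
    and "uq_act q (uq_x q) = Gamma_X"
    and "uq_act q (uq_xinv q) = Gamma_Xinv"
    by (simp_all add: uq_x_def uq_xinv_def uq_act_class[OF assms] fun_eq_iff)
  show "uq_act q (uq_y q) = Gamma_Y q"
    using nz by (simp add: uq_y_def uq_act_class[OF assms] fun_eq_iff free_act_add free_act_mult
        GY.scale GXi.scale flip: fsv.scale_right_diff_distrib)
  have "free_act q (gen Gen_e * cst (q * (q - inverse q))) w = w - Gamma_X (Gamma_Z q w)" for w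
    using nz assms(1) by (simp add: free_act_mult GX.scale GZ.scale
        del: inverse_mult_distrib flip: fsv.scale_right_diff_distrib)
  then have "free_act q (gen Gen_kinv - gen Gen_kinv * gen Gen_e * cst (q * (q - inverse q))) w
      = Gamma_Z q w" for w
    by (simp add: free_act_diff mult.assoc free_act_mult[of q "gen Gen_kinv"] GXi.diff Gamma_Xinv_X)
  then show "uq_act q (uq_z q) = Gamma_Z q"
    by (simp add: uq_z_def uq_act_class[OF assms] fun_eq_iff)
qed

end

theory Submission
  imports Defs
begin

text \<open>
  Both coefficients in the formula for \<open>z v\<^sub>i\<^sub>j\<close> carry a factor that vanishes at \<open>i = j = 0\<close>,
  namely \<open>q\<^sup>i - q\<^sup>-\<^sup>i\<close> and \<open>q\<^sup>j - q\<^sup>-\<^sup>j\<close>, so \<open>z\<close> kills the basis vector \<open>v\<^sub>0\<^sub>0\<close>. A linear map with a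
  nonzero vector in its kernel is not injective, so \<open>z\<close> is not invertible on \<open>\<Gamma>\<^sub>z\<close>. An inverse of
  \<open>z\<close> in \<open>U\<^sub>q(sl\<^sub>2)\<close> would act on the module as an inverse of the operator \<open>z\<close>
  (\<open>bij_uq_act_Units\<close>), so there is none.
\<close>

lemma vv_nonzero: "j \<ge> 0 \<Longrightarrow> (vv i j :: 'k::field Gamma) \<noteq> 0"
  by (metis lookup_single_eq lookup_zero vv_def not_less zero_neq_one)

lemma Gamma_Z_vv00: "Gamma_Z q (vv 0 0) = 0"
  by (simp add: Gamma_Z_vv)

text \<open>
  The action is a homomorphism of unital rings into the linear operators under composition, so
  it carries a two-sided inverse in the algebra to a two-sided inverse map.
\<close>

lemma bij_uq_act_Units:
  assumes q: "q \<noteq> 0" "q ^ 2 \<noteq> 1" and a: "a \<in> Units (Uq q)"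
  shows "bij (uq_act q a)"
proof -
  from a obtain b where carrier: "a \<in> carrier (Uq q)" "b \<in> carrier (Uq q)"
    and inv: "a \<otimes>\<^bsub>Uq q\<^esub> b = \<one>\<^bsub>Uq q\<^esub>" "b \<otimes>\<^bsub>Uq q\<^esub> a = \<one>\<^bsub>Uq q\<^esub>"
    unfolding Units_def by blast
  note hom = uq_act_ring_hom[OF q]
  have "uq_act q a \<circ> uq_act q b = id" "uq_act q b \<circ> uq_act q a = id"
    using ring_hom_mult[OF hom carrier] ring_hom_mult[OF hom carrier(2,1)] ring_hom_one[OF hom]
    by (simp_all add: inv Gamma_End_def)
  then show ?thesis
    using o_bij by blast
qed

theorem lemma3p5:
  fixes q :: "'k::field"
  assumes "q \<noteq> 0" and "q ^ 2 \<noteq> 1"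
  shows "uq_act q (uq_z q) (vv 0 0) = 0
    \<and> \<not> bij (uq_act q (uq_z q))
    \<and> uq_z q \<notin> Units (Uq q)"
proof -
  have z: "uq_act q (uq_z q) = Gamma_Z q"
    by (rule uq_act_generators(5)[OF assms])
  have "\<not> inj (Gamma_Z q)"
    using Gamma_Z_vv00[of q] GZ.zero[of q] vv_nonzero[of 0 0] by (metis injD order_refl)
  then have "\<not> bij (uq_act q (uq_z q))"
    by (simp add: z bij_def)
  then show ?thesis
    using bij_uq_act_Units[OF assms] Gamma_Z_vv00[of q] z by metis
qed

end
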